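(* For a 2-functor (i.e. locally monotone functor) $T:\mathsf{Pre}\to\mathsf{Pre}$ the following are equivalent: (1) there is a 2-functor $\overline{T}:\mathsf{Rel}(\mathsf{Pre})\to\mathsf{Rel}(\mathsf{Pre})$ with $\overline{T}\circ(-)_\diamond=(-)_\diamond\circ T$; (2) $T$ satisfies the Beck–Chevalley Condition, i.e. $T$ preserves exact squares; (3) there is a distributive law $T\circ\mathbb{L}\to\mathbb{L}\circ T$ of $T$ over the KZ doctrine $(\mathbb{L},\mathbb{y},\mathbb{m})$.
   Context: $\mathsf{Pre}$: preorders, monotone maps, 2-cells $f\le g$ pointwise; $T$ is locally monotone if $f\le g$ implies $Tf\le Tg$. $\mathscr{A}(a,a')\in\{0,1\}$ is the truth value of $a\le a'$, $\mathbb{2}=\{0\le1\}$. $\mathsf{Rel}(\mathsf{Pre})$: objects preorders; 1-cells from $\mathscr{A}$ to $\mathscr{B}$ are monotone maps $R:\mathscr{B}^{op}\times\mathscr{A}\to\mathbb{2}$; composition $(S\cdot R)(c,a)=\bigvee_bR(b,a)\wedge S(c,b)$; identities $(a',a)\mapsto\mathscr{A}(a',a)$; 2-cells pointwise order. $(-)_\diamond:\mathsf{Pre}\to\mathsf{Rel}(\mathsf{Pre})$ is identity on objects and $f_\diamond(b,a)=\mathscr{B}(b,fa)$ for $f:\mathscr{A}\to\mathscr{B}$. A lax square $p_0:\mathscr{P}\to\mathscr{A}$, $p_1:\mathscr{P}\to\mathscr{B}$, $f:\mathscr{A}\to\mathscr{C}$, $g:\mathscr{B}\to\mathscr{C}$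 with $fp_0\le gp_1$ pointwise is exact iff $\mathscr{C}(fa,gb)=\bigvee_w\mathscr{A}(a,p_0w)\wedge\mathscr{B}(p_1w,b)$ for all $a,b$; $T$ preserves exact squares if it maps each exact lax square to an exact (lax) square. The KZ doctrine $(\mathbb{L},\mathbb{y},\mathbb{m})$: $\mathbb{L}\mathscr{A}=[\mathscr{A}^{op},\mathbb{2}]$ is the poset of lowersets of $\mathscr{A}$ ordered by inclusion; for monotone $f:\mathscr{A}\to\mathscr{C}$, $(\mathbb{L}f)(W)=\{c: \exists a\in W,\ c\le fa\}$; $\mathbb{y}_{\mathscr{A}}(a)=\{a':a'\le a\}$; $\mathbb{m}_{\mathscr{A}}(\mathscr{W})=\bigcup_{W\in\mathscr{W}}W$. A distributive law of $T$ over $\mathbb{L}$ is a natural transformation $\lambda:T\mathbb{L}\to\mathbb{L}T$ with $\lambda_{\mathscr{A}}\circ T\mathbb{y}_{\mathscr{A}}=\mathbb{y}_{T\mathscr{A}}$ and $\lambda_{\mathscr{A}}\circ T\mathbb{m}_{\mathscr{A}}=\mathbb{m}_{T\mathscr{A}}\circ\mathbb{L}\lambda_{\mathscr{A}}\circ\lambda_{\mathbb{L}\mathscr{A}}$. *)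

theory Defs
  imports "HOL-Library.FuncSet"
begin

text \<open>
  Locally ordered categories and their 2-functors. The data of a category are carried by a record;
  a morphism does not determine its domain and codomain, so these are passed along.
  \<open>Comp C A B D g f\<close> is the composite of \<open>f : A \<rightarrow> B\<close> with \<open>g : B \<rightarrow> D\<close>, and
  \<open>Le C A B f g\<close> says that there is a 2-cell from \<open>f\<close> to \<open>g\<close> in the hom-set from \<open>A\<close> to \<open>B\<close>.
\<close>

record ('o, 'm) ordcat =
  Obj :: "'o set"
  Hom :: "'o \<Rightarrow> 'o \<Rightarrow> 'm set"
  Idt :: "'o \<Rightarrow> 'm"
  Comp :: "'o \<Rightarrow> 'o \<Rightarrow> 'o \<Rightarrow> 'm \<Rightarrow> 'm \<Rightarrow> 'm"
  Le :: "'o \<Rightarrow> 'o \<Rightarrow> 'm \<Rightarrow> 'm \<Rightarrow> bool"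

record ('o, 'm, 'p, 'n) functor_data =
  onObj :: "'o \<Rightarrow> 'p"
  onHom :: "'o \<Rightarrow> 'o \<Rightarrow> 'm \<Rightarrow> 'n"

definition two_functor ::
  "('o, 'm) ordcat \<Rightarrow> ('p, 'n) ordcat \<Rightarrow> ('o, 'm, 'p, 'n) functor_data \<Rightarrow> bool" where
  "two_functor C D F \<longleftrightarrow>
     (\<forall>A\<in>Obj C. onObj F A \<in> Obj D) \<and>
     (\<forall>A\<in>Obj C. \<forall>B\<in>Obj C. \<forall>f\<in>Hom C A B. onHom F A B f \<in> Hom D (onObj F A) (onObj F B)) \<and>
     (\<forall>A\<in>Obj C. onHom F A A (Idt C A) = Idt D (onObj F A)) \<and>
     (\<forall>A\<in>Obj C. \<forall>B\<in>Obj C. \<forall>E\<in>Obj C. \<forall>f\<in>Hom C A B. \<forall>g\<in>Hom C B E.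
        onHom F A E (Comp C A B E g f) =
        Comp D (onObj F A) (onObj F B) (onObj F E) (onHom F B E g) (onHom F A B f)) \<and>
     (\<forall>A\<in>Obj C. \<forall>B\<in>Obj C. \<forall>f\<in>Hom C A B. \<forall>g\<in>Hom C A B.
        Le C A B f g \<longrightarrow> Le D (onObj F A) (onObj F B) (onHom F A B f) (onHom F A B g))"

definition functor_comp ::
  "('p, 'n, 'q, 'k) functor_data \<Rightarrow> ('o, 'm, 'p, 'n) functor_data \<Rightarrow> ('o, 'm, 'q, 'k) functor_data" where
  "functor_comp G F =
     \<lparr>onObj = (\<lambda>A. onObj G (onObj F A)),
      onHom = (\<lambda>A B f. onHom G (onObj F A) (onObj F B) (onHom F A B f))\<rparr>"

text \<open>Equality of functors with domain \<open>C\<close>; values outside \<open>C\<close> are ignored.\<close>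

definition functor_eq ::
  "('o, 'm) ordcat \<Rightarrow> ('o, 'm, 'p, 'n) functor_data \<Rightarrow> ('o, 'm, 'p, 'n) functor_data \<Rightarrow> bool" where
  "functor_eq C F G \<longleftrightarrow>
     (\<forall>A\<in>Obj C. onObj F A = onObj G A) \<and>
     (\<forall>A\<in>Obj C. \<forall>B\<in>Obj C. \<forall>f\<in>Hom C A B. onHom F A B f = onHom G A B f)"

definition natural_transformation ::
  "('o, 'm) ordcat \<Rightarrow> ('p, 'n) ordcat \<Rightarrow> ('o, 'm, 'p, 'n) functor_data \<Rightarrow>
   ('o, 'm, 'p, 'n) functor_data \<Rightarrow> ('o \<Rightarrow> 'n) \<Rightarrow> bool" where
  "natural_transformation C D F G \<alpha> \<longleftrightarrow>
     (\<forall>A\<in>Obj C. \<alpha> A \<in> Hom D (onObj F A) (onObj G A)) \<and>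
     (\<forall>A\<in>Obj C. \<forall>B\<in>Obj C. \<forall>f\<in>Hom C A B.
        Comp D (onObj F A) (onObj F B) (onObj G B) (\<alpha> B) (onHom F A B f) =
        Comp D (onObj F A) (onObj G A) (onObj G B) (onHom G A B f) (\<alpha> A))"

text \<open>A distributive law \<open>\<lambda> : T S \<rightarrow> S T\<close> of the functor \<open>T\<close> over the monad \<open>(S, \<eta>, \<mu>)\<close> on \<open>C\<close>.\<close>

definition distributive_law ::
  "('o, 'm) ordcat \<Rightarrow> ('o, 'm, 'o, 'm) functor_data \<Rightarrow>
   ('o, 'm, 'o, 'm) functor_data \<Rightarrow> ('o \<Rightarrow> 'm) \<Rightarrow> ('o \<Rightarrow> 'm) \<Rightarrow> ('o \<Rightarrow> 'm) \<Rightarrow> bool" where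
  "distributive_law C T S \<eta> \<mu> \<Lambda> \<longleftrightarrow>
     natural_transformation C C (functor_comp T S) (functor_comp S T) \<Lambda> \<and>
     (\<forall>A\<in>Obj C.
        let TA = onObj T A; SA = onObj S A; SSA = onObj S SA;
            TSA = onObj T SA; TSSA = onObj T SSA;
            STA = onObj S TA; SSTA = onObj S STA; STSA = onObj S TSA
        in Comp C TA TSA STA (\<Lambda> A) (onHom T A SA (\<eta> A)) = \<eta> TA \<and>
           Comp C TSSA TSA STA (\<Lambda> A) (onHom T SSA SA (\<mu> A)) =
           Comp C TSSA SSTA STA (\<mu> TA)
             (Comp C TSSA STSA SSTA (onHom S TSA STA (\<Lambda> A)) (\<Lambda> SA)))"

text \<open>
  The category of preorders is formed relative to a Grothendieck universe, represented by a type
  \<open>'u\<close>: \<open>small X\<close> means that the set \<open>X\<close> of elements of the universe is itself (via \<open>code\<close>) an element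
  of the universe. The conditions are closure under unordered pairs, subsets, power sets and unions
  of small families; as in SGA 4, an infinite member is not required, so that the hereditarily
  finite sets are also an instance.
\<close>

definition universe :: "('u set \<Rightarrow> bool) \<Rightarrow> ('u set \<Rightarrow> 'u) \<Rightarrow> bool" where
  "universe small code \<longleftrightarrow>
     inj_on code {X. small X} \<and>
     (\<forall>x y. small {x, y}) \<and>
     (\<forall>X Y. small X \<and> Y \<subseteq> X \<longrightarrow> small Y) \<and>
     (\<forall>X. small X \<longrightarrow> small (code ` Pow X)) \<and>
     (\<forall>X F. small X \<and> (\<forall>x\<in>X. small (F x)) \<longrightarrow> small (\<Union>x\<in>X. F x))"

text \<open>
  A preorder is identified with its order relation \<open>A\<close>; its carrier is \<open>Field A\<close> by reflexivity, and
  \<open>(a, a') \<in> A\<close> means \<open>a \<le> a'\<close>. Monotone maps are extensional functions, so that equality of maps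
  is equality on the carrier.
\<close>

definition Pre :: "('u set \<Rightarrow> bool) \<Rightarrow> ('u rel, 'u \<Rightarrow> 'u) ordcat" where
  "Pre small =
     \<lparr>Obj = {A. Preorder A \<and> small (Field A)},
      Hom = (\<lambda>A B. {f \<in> Field A \<rightarrow>\<^sub>E Field B. \<forall>a a'. (a, a') \<in> A \<longrightarrow> (f a, f a') \<in> B}),
      Idt = (\<lambda>A. \<lambda>a\<in>Field A. a),
      Comp = (\<lambda>A B C g f. compose (Field A) g f),
      Le = (\<lambda>A B f g. \<forall>a\<in>Field A. (f a, g a) \<in> B)\<rparr>"

text \<open>
  A monotone map \<open>R : B\<^sup>o\<^sup>p \<times> A \<rightarrow> 2\<close>, that is, a 1-cell from \<open>A\<close> to \<open>B\<close>, is represented by the set of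
  pairs \<open>(b, a)\<close> on which it takes the value 1. Then the identity on \<open>A\<close> is \<open>A\<close> itself, and the
  composite \<open>S \<cdot> R\<close> is \<open>S O R\<close>, the set of pairs \<open>(c, a)\<close> such that
  \<open>(c, b) \<in> S\<close> and \<open>(b, a) \<in> R\<close> for some \<open>b\<close>.
\<close>

definition RelPre :: "('u set \<Rightarrow> bool) \<Rightarrow> ('u rel, 'u rel) ordcat" where
  "RelPre small =
     \<lparr>Obj = {A. Preorder A \<and> small (Field A)},
      Hom = (\<lambda>A B. {R. R \<subseteq> Field B \<times> Field A \<and>
               (\<forall>b b' a a'. (b', b) \<in> B \<and> (a, a') \<in> A \<and> (b, a) \<in> R \<longrightarrow> (b', a') \<in> R)}),
      Idt = (\<lambda>A. A),
      Comp = (\<lambda>A B C S R. S O R),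
      Le = (\<lambda>A B R S. R \<subseteq> S)\<rparr>"

definition diamond :: "('u rel, 'u \<Rightarrow> 'u, 'u rel, 'u rel) functor_data" where
  "diamond =
     \<lparr>onObj = (\<lambda>A. A),
      onHom = (\<lambda>A B f. {(b, a). a \<in> Field A \<and> (b, f a) \<in> B})\<rparr>"

definition lax_square ::
  "('u set \<Rightarrow> bool) \<Rightarrow> 'u rel \<Rightarrow> 'u rel \<Rightarrow> 'u rel \<Rightarrow> 'u rel \<Rightarrow>
   ('u \<Rightarrow> 'u) \<Rightarrow> ('u \<Rightarrow> 'u) \<Rightarrow> ('u \<Rightarrow> 'u) \<Rightarrow> ('u \<Rightarrow> 'u) \<Rightarrow> bool" where
  "lax_square small P A B C p0 p1 f g \<longleftrightarrow>
     {P, A, B, C} \<subseteq> Obj (Pre small) \<and>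
     p0 \<in> Hom (Pre small) P A \<and> p1 \<in> Hom (Pre small) P B \<and>
     f \<in> Hom (Pre small) A C \<and> g \<in> Hom (Pre small) B C \<and>
     Le (Pre small) P C (Comp (Pre small) P A C f p0) (Comp (Pre small) P B C g p1)"

definition exact_square ::
  "('u set \<Rightarrow> bool) \<Rightarrow> 'u rel \<Rightarrow> 'u rel \<Rightarrow> 'u rel \<Rightarrow> 'u rel \<Rightarrow>
   ('u \<Rightarrow> 'u) \<Rightarrow> ('u \<Rightarrow> 'u) \<Rightarrow> ('u \<Rightarrow> 'u) \<Rightarrow> ('u \<Rightarrow> 'u) \<Rightarrow> bool" where
  "exact_square small P A B C p0 p1 f g \<longleftrightarrow>
     lax_square small P A B C p0 p1 f g \<and>
     (\<forall>a\<in>Field A. \<forall>b\<in>Field B.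
        (f a, g b) \<in> C \<longleftrightarrow> (\<exists>w\<in>Field P. (a, p0 w) \<in> A \<and> (p1 w, b) \<in> B))"

definition preserves_exact_squares ::
  "('u set \<Rightarrow> bool) \<Rightarrow> ('u rel, 'u \<Rightarrow> 'u, 'u rel, 'u \<Rightarrow> 'u) functor_data \<Rightarrow> bool" where
  "preserves_exact_squares small T \<longleftrightarrow>
     (\<forall>P A B C p0 p1 f g. exact_square small P A B C p0 p1 f g \<longrightarrow>
        exact_square small (onObj T P) (onObj T A) (onObj T B) (onObj T C)
          (onHom T P A p0) (onHom T P B p1) (onHom T A C f) (onHom T B C g))"

text \<open>
  The elements of \<open>L A\<close> are the codes of the lowersets of \<open>A\<close>, and \<open>decode\<close> recovers a small set
  from its code.
\<close>

definition decode :: "('u set \<Rightarrow> bool) \<Rightarrow> ('u set \<Rightarrow> 'u) \<Rightarrow> 'u \<Rightarrow> 'u set" where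
  "decode small code = inv_into {X. small X} code"

definition lowersets :: "'u rel \<Rightarrow> 'u set set" where
  "lowersets A = {W. W \<subseteq> Field A \<and> (\<forall>a a'. a \<in> W \<and> (a', a) \<in> A \<longrightarrow> a' \<in> W)}"

definition L_obj :: "('u set \<Rightarrow> 'u) \<Rightarrow> 'u rel \<Rightarrow> 'u rel" where
  "L_obj code A = {(code V, code W) | V W. V \<in> lowersets A \<and> W \<in> lowersets A \<and> V \<subseteq> W}"

definition L ::
  "('u set \<Rightarrow> bool) \<Rightarrow> ('u set \<Rightarrow> 'u) \<Rightarrow> ('u rel, 'u \<Rightarrow> 'u, 'u rel, 'u \<Rightarrow> 'u) functor_data" where
  "L small code =
     \<lparr>onObj = L_obj code,
      onHom = (\<lambda>A C f. \<lambda>w\<in>Field (L_obj code A).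
                 code {c. \<exists>a\<in>decode small code w. (c, f a) \<in> C})\<rparr>"

definition yoneda :: "('u set \<Rightarrow> 'u) \<Rightarrow> 'u rel \<Rightarrow> 'u \<Rightarrow> 'u" where
  "yoneda code A = (\<lambda>a\<in>Field A. code {a'. (a', a) \<in> A})"

definition mult :: "('u set \<Rightarrow> bool) \<Rightarrow> ('u set \<Rightarrow> 'u) \<Rightarrow> 'u rel \<Rightarrow> 'u \<Rightarrow> 'u" where
  "mult small code A = (\<lambda>w\<in>Field (L_obj code (L_obj code A)).
     code (\<Union>v\<in>decode small code w. decode small code v))"

end

theory Submission
  imports Defs
begin

text \<open>
  The implications are proved in a cycle. A map \<open>f\<close> gives a left adjoint \<open>f\<^sub>\<diamond>\<close> in \<open>Rel(Pre)\<close>, with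
  right adjoint \<open>(a, c) \<mapsto> C(fa, c)\<close>, and a square is exact iff the two composites of left and right
  adjoints around it agree; an extension of \<open>T\<close> preserves composites and adjoints, hence exactness.
  If \<open>T\<close> preserves exact squares, then \<open>W \<mapsto> {a. Ty a \<le> W}\<close> is a distributive law: each of its
  axioms is the exactness of the image under \<open>T\<close> of one square, and these squares all have \<open>A\<close>
  itself as their apex. Finally, \<open>Rel(Pre)\<close> is the Kleisli category of \<open>L\<close>, so a distributive law
  extends \<open>T\<close> by sending \<open>r : A \<rightarrow> LB\<close> to the composite of \<open>Tr\<close> with the component of the law at \<open>B\<close>.
\<close>

section \<open>Preorders, monotone maps and lax squares\<close>

lemma preorder_refl: "Preorder A \<Longrightarrow> a \<in> Field A \<Longrightarrow> (a, a) \<in> A"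
  by (simp add: preorder_on_def refl_on_def)

lemma preorder_trans: "Preorder A \<Longrightarrow> (a, b) \<in> A \<Longrightarrow> (b, c) \<in> A \<Longrightarrow> (a, c) \<in> A"
  unfolding preorder_on_def by (blast dest: transD)

lemma in_Obj_iff: "A \<in> Obj (Pre small) \<longleftrightarrow> Preorder A \<and> small (Field A)"
  by (simp add: Pre_def)

lemma Obj_RelPre: "Obj (RelPre small) = Obj (Pre small)"
  by (simp add: Pre_def RelPre_def)

lemma Obj_refl: "A \<in> Obj (Pre small) \<Longrightarrow> a \<in> Field A \<Longrightarrow> (a, a) \<in> A"
  by (simp add: in_Obj_iff preorder_refl)

lemma Obj_trans: "A \<in> Obj (Pre small) \<Longrightarrow> (a, b) \<in> A \<Longrightarrow> (b, c) \<in> A \<Longrightarrow> (a, c) \<in> A"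
  unfolding in_Obj_iff by (blast intro: preorder_trans)

lemma HomI:
  assumes "f \<in> extensional (Field A)" "\<And>a. a \<in> Field A \<Longrightarrow> f a \<in> Field B"
    "\<And>a a'. (a, a') \<in> A \<Longrightarrow> (f a, f a') \<in> B"
  shows "f \<in> Hom (Pre small) A B"
  using assms by (auto simp: Pre_def PiE_def)

lemma Hom_Field: "f \<in> Hom (Pre small) A B \<Longrightarrow> a \<in> Field A \<Longrightarrow> f a \<in> Field B"
  by (auto simp: Pre_def)

lemma Hom_mono: "f \<in> Hom (Pre small) A B \<Longrightarrow> (a, a') \<in> A \<Longrightarrow> (f a, f a') \<in> B"
  by (auto simp: Pre_def)

lemma Hom_ext: "f \<in> Hom (Pre small) A B \<Longrightarrow> f \<in> extensional (Field A)"
  by (auto simp: Pre_def PiE_def)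

lemma Hom_eqI:
  assumes "f \<in> Hom (Pre small) A B" "g \<in> Hom (Pre small) A B" "\<And>a. a \<in> Field A \<Longrightarrow> f a = g a"
  shows "f = g"
  using assms by (auto intro: extensionalityI dest: Hom_ext)

lemma Comp_Pre: "Comp (Pre small) A B C g f = compose (Field A) g f"
  by (simp add: Pre_def)

lemma Idt_Pre: "Idt (Pre small) A = restrict (\<lambda>a. a) (Field A)"
  by (simp add: Pre_def)

lemma Le_Pre: "Le (Pre small) A B f g \<longleftrightarrow> (\<forall>a\<in>Field A. (f a, g a) \<in> B)"
  by (simp add: Pre_def)

lemma compose_Hom:
  assumes "f \<in> Hom (Pre small) A B" "g \<in> Hom (Pre small) B C"
  shows "compose (Field A) g f \<in> Hom (Pre small) A C"
proof (rule HomI)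
  show "(compose (Field A) g f a, compose (Field A) g f a') \<in> C" if "(a, a') \<in> A" for a a'
    using that Hom_mono[OF assms(2) Hom_mono[OF assms(1) that]]
    by (simp add: compose_eq FieldI1 FieldI2)
qed (auto simp: compose_eq intro: Hom_Field assms)

lemma id_Hom: "restrict (\<lambda>a. a) (Field A) \<in> Hom (Pre small) A A"
  by (rule HomI) (auto simp: FieldI1 FieldI2)

lemma lax_square_iff:
  "lax_square small P A B C p0 p1 f g \<longleftrightarrow>
     {P, A, B, C} \<subseteq> Obj (Pre small) \<and>
     p0 \<in> Hom (Pre small) P A \<and> p1 \<in> Hom (Pre small) P B \<and>
     f \<in> Hom (Pre small) A C \<and> g \<in> Hom (Pre small) B C \<and>
     (\<forall>w\<in>Field P. (f (p0 w), g (p1 w)) \<in> C)"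
  by (auto simp: lax_square_def Comp_Pre Le_Pre compose_eq)

section \<open>Adjoint relations and the relational form of exactness\<close>

text \<open>The right adjoint of \<open>onHom diamond A C f\<close>, a 1-cell from \<open>C\<close>
  to \<open>A\<close>. The adjunction consists of \<open>diamond_unit\<close> and
  \<open>diamond_counit\<close>; the triangle identities are automatic, since parallel 2-cells are
  equal.\<close>

definition codiamond :: "'u rel \<Rightarrow> 'u rel \<Rightarrow> ('u \<Rightarrow> 'u) \<Rightarrow> 'u rel" where
  "codiamond A C f = {(a, c). a \<in> Field A \<and> (f a, c) \<in> C}"

lemma onHom_diamond: "onHom diamond A B f = {(b, a). a \<in> Field A \<and> (b, f a) \<in> B}"
  by (simp add: diamond_def)

lemma onObj_diamond: "onObj diamond A = A"
  by (simp add: diamond_def)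

lemma RelPre_simps:
  "Idt (RelPre small) A = A" "Comp (RelPre small) A B C S R = S O R"
  "Le (RelPre small) A B R S \<longleftrightarrow> R \<subseteq> S"
  by (simp_all add: RelPre_def)

lemma Hom_RelPre:
  "R \<in> Hom (RelPre small) A B \<longleftrightarrow> R \<subseteq> Field B \<times> Field A \<and>
     (\<forall>b b' a a'. (b', b) \<in> B \<and> (a, a') \<in> A \<and> (b, a) \<in> R \<longrightarrow> (b', a') \<in> R)"
  by (simp add: RelPre_def)

lemma diamond_Hom:
  assumes "A \<in> Obj (Pre small)" "B \<in> Obj (Pre small)" "f \<in> Hom (Pre small) A B"
  shows "onHom diamond A B f \<in> Hom (RelPre small) A B"
  unfolding Hom_RelPre onHom_diamond
  by (auto intro: FieldI1 FieldI2) (meson assms Hom_mono Obj_trans)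

lemma codiamond_Hom:
  assumes "A \<in> Obj (Pre small)" "B \<in> Obj (Pre small)" "f \<in> Hom (Pre small) A B"
  shows "codiamond A B f \<in> Hom (RelPre small) B A"
  unfolding Hom_RelPre codiamond_def
  by (auto intro: FieldI1 FieldI2) (meson assms Hom_mono Obj_trans)

lemma diamond_unit:
  assumes "A \<in> Obj (Pre small)" "B \<in> Obj (Pre small)" "f \<in> Hom (Pre small) A B"
  shows "A \<subseteq> codiamond A B f O onHom diamond A B f"
proof (rule subrelI)
  fix a a' assume "(a, a') \<in> A"
  then have "(f a, f a') \<in> B" "a \<in> Field A" "a' \<in> Field A"
    by (auto intro: FieldI1 FieldI2 Hom_mono[OF assms(3)])
  \<comment> \<open>As f a \<le> f a' \<le> f a', the middle element of the composite relation is
    \<open>f a'\<close>.\<close>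
  moreover from this have "(f a', f a') \<in> B" using assms by (auto intro: Obj_refl Hom_Field)
  ultimately show "(a, a') \<in> codiamond A B f O onHom diamond A B f"
    by (auto simp: codiamond_def onHom_diamond)
qed

lemma diamond_counit:
  assumes "B \<in> Obj (Pre small)"
  shows "onHom diamond A B f O codiamond A B f \<subseteq> B"
  using Obj_trans[OF assms] by (auto simp: codiamond_def onHom_diamond)

text \<open>Reflexivity of \<open>B\<close> gives one inclusion, closure of \<open>R\<close> under
  smaller elements of \<open>B\<close> the other.\<close>

lemma RelPre_Idt_left:
  assumes "A \<in> Obj (Pre small)" "B \<in> Obj (Pre small)" "R \<in> Hom (RelPre small) A B"
  shows "B O R = R"
proof -
  have R: "R \<subseteq> Field B \<times> Field A"
    and sat: "\<And>b b' a a'. (b', b) \<in> B \<Longrightarrow> (a, a') \<in> A \<Longrightarrow> (b, a) \<in> R \<Longrightarrow> (b', a') \<in> R"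
    using assms(3) unfolding Hom_RelPre by blast+
  have "R \<subseteq> B O R" using R Obj_refl[OF assms(2)] by auto
  moreover have "(b', a) \<in> R" if "(b', b) \<in> B" "(b, a) \<in> R" for b b' a
    using sat[OF that(1) Obj_refl[OF assms(1)] that(2)] R that(2) by auto
  ultimately show ?thesis by auto
qed

lemma RelPre_Idt_right:
  assumes "A \<in> Obj (Pre small)" "B \<in> Obj (Pre small)" "R \<in> Hom (RelPre small) A B"
  shows "R O A = R"
proof -
  have R: "R \<subseteq> Field B \<times> Field A"
    and sat: "\<And>b b' a a'. (b', b) \<in> B \<Longrightarrow> (a, a') \<in> A \<Longrightarrow> (b, a) \<in> R \<Longrightarrow> (b', a') \<in> R"
    using assms(3) unfolding Hom_RelPre by blast+
  have "R \<subseteq> R O A" using R Obj_refl[OF assms(1)] by auto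
  moreover have "(b, a') \<in> R" if "(b, a) \<in> R" "(a, a') \<in> A" for b a a'
    using sat[OF Obj_refl[OF assms(2)] that(2,1)] R that(1) by auto
  ultimately show ?thesis by auto
qed

lemma RelPre_Idt_Hom: "A \<in> Obj (Pre small) \<Longrightarrow> A \<in> Hom (RelPre small) A A"
  unfolding Hom_RelPre by (auto intro: FieldI1 FieldI2) (meson Obj_trans)

lemma RelPre_Comp_Hom:
  assumes B: "B \<in> Obj (Pre small)"
    and R: "R \<in> Hom (RelPre small) A B" and S: "S \<in> Hom (RelPre small) B C"
  shows "S O R \<in> Hom (RelPre small) A C"
proof -
  have "S O R \<subseteq> Field C \<times> Field A" using R S by (auto simp: Hom_RelPre)
  moreover have "(c', a') \<in> S O R" if "(c', c) \<in> C" "(a, a') \<in> A" "(c, a) \<in> S O R" for c c' a a'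
  proof -
    from that(3) obtain b where b: "(c, b) \<in> S" "(b, a) \<in> R" by blast
    \<comment> \<open>Reflexivity at \<open>b\<close> lets each closure condition move one
      coordinate while the middle element stays fixed.\<close>
    then have "(b, b) \<in> B" using R by (auto simp: Hom_RelPre intro: Obj_refl[OF B])
    then have "(c', b) \<in> S" "(b, a') \<in> R"
      using b that(1,2) R S unfolding Hom_RelPre by blast+
    then show ?thesis by blast
  qed
  ultimately show ?thesis unfolding Hom_RelPre by blast
qed

text \<open>Both composites are 1-cells from \<open>B\<close> to \<open>A\<close>. Through
  \<open>C\<close> the middle element may be taken to be \<open>f a\<close>, which leaves f a \<le>
  g b; through \<open>P\<close> it is the \<open>w\<close> of the exactness formula. In this form
  exactness mentions only composition and adjoints.\<close>

lemma exact_square_iff_rel: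
  assumes "lax_square small P A B C p0 p1 f g"
  shows "exact_square small P A B C p0 p1 f g \<longleftrightarrow>
    codiamond A C f O onHom diamond B C g = onHom diamond P A p0 O codiamond P B p1"
proof -
  have C: "C \<in> Obj (Pre small)" and f: "f \<in> Hom (Pre small) A C"
    and p1: "p1 \<in> Hom (Pre small) P B"
    using assms by (auto simp: lax_square_iff)
  have "(a, b) \<in> codiamond A C f O onHom diamond B C g \<longleftrightarrow>
      a \<in> Field A \<and> b \<in> Field B \<and> (f a, g b) \<in> C" for a b
    using Obj_trans[OF C] Obj_refl[OF C] Hom_Field[OF f]
    unfolding codiamond_def onHom_diamond relcomp_unfold by blast
  moreover have "(a, b) \<in> onHom diamond P A p0 O codiamond P B p1 \<longleftrightarrow>
      a \<in> Field A \<and> b \<in> Field B \<and> (\<exists>w\<in>Field P. (a, p0 w) \<in> A \<and> (p1 w, b) \<in> B)" for a b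
    by (auto simp: codiamond_def onHom_diamond intro: FieldI1 FieldI2)
  ultimately show ?thesis
    using assms unfolding exact_square_def by (simp add: set_eq_iff) meson
qed

section \<open>2-functors on the category of preorders\<close>

locale pre_two_functor =
  fixes small :: "'u set \<Rightarrow> bool"
    and T :: "('u rel, 'u \<Rightarrow> 'u, 'u rel, 'u \<Rightarrow> 'u) functor_data"
  assumes T: "two_functor (Pre small) (Pre small) T"
begin

abbreviation "PO \<equiv> Obj (Pre small)"
abbreviation "hom \<equiv> Hom (Pre small)"
abbreviation "Rel \<equiv> Hom (RelPre small)"
abbreviation "To \<equiv> onObj T"
abbreviation "Tm \<equiv> onHom T"

lemma T_Obj: "A \<in> PO \<Longrightarrow> To A \<in> PO"
  using T by (simp add: two_functor_def)

lemma T_Hom: "A \<in> PO \<Longrightarrow> B \<in> PO \<Longrightarrow> f \<in> hom A B \<Longrightarrow> Tm A B f \<in> hom (To A) (To B)"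
  using T by (simp add: two_functor_def)

lemma T_Idt: "A \<in> PO \<Longrightarrow> Tm A A (restrict (\<lambda>a. a) (Field A)) = restrict (\<lambda>a. a) (Field (To A))"
  using T by (simp add: two_functor_def Idt_Pre)

lemma T_compose:
  assumes "A \<in> PO" "B \<in> PO" "C \<in> PO" "f \<in> hom A B" "g \<in> hom B C"
  shows "Tm A C (compose (Field A) g f) = compose (Field (To A)) (Tm B C g) (Tm A B f)"
proof -
  have "\<forall>A\<in>PO. \<forall>B\<in>PO. \<forall>C\<in>PO. \<forall>f\<in>hom A B. \<forall>g\<in>hom B C.
      Tm A C (compose (Field A) g f) = compose (Field (To A)) (Tm B C g) (Tm A B f)"
    using T by (simp add: two_functor_def Comp_Pre)
  then show ?thesis using assms by blast
qed

lemma T_compose_app: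
  assumes "A \<in> PO" "B \<in> PO" "C \<in> PO" "f \<in> hom A B" "g \<in> hom B C" "x \<in> Field (To A)"
  shows "Tm A C (compose (Field A) g f) x = Tm B C g (Tm A B f x)"
  using assms by (simp add: T_compose compose_eq)

lemma T_mono:
  assumes "A \<in> PO" "B \<in> PO" "f \<in> hom A B" "g \<in> hom A B"
    and "\<And>a. a \<in> Field A \<Longrightarrow> (f a, g a) \<in> B" "x \<in> Field (To A)"
  shows "(Tm A B f x, Tm A B g x) \<in> To B"
proof -
  have "\<forall>A\<in>PO. \<forall>B\<in>PO. \<forall>f\<in>hom A B. \<forall>g\<in>hom A B. (\<forall>a\<in>Field A. (f a, g a) \<in> B) \<longrightarrow>
      (\<forall>x\<in>Field (To A). (Tm A B f x, Tm A B g x) \<in> To B)"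
    using T by (simp add: two_functor_def Le_Pre)
  then show ?thesis using assms by blast
qed

text \<open>Functoriality and local monotonicity, applied to the two composites into
  \<open>C\<close>, preserve laxity. Hence only the existence formula remains to be checked for
  exactness of the image.\<close>

lemma T_lax_square:
  assumes "lax_square small P A B C p0 p1 f g"
  shows "lax_square small (To P) (To A) (To B) (To C) (Tm P A p0) (Tm P B p1) (Tm A C f) (Tm B C g)"
proof -
  have obj: "P \<in> PO" "A \<in> PO" "B \<in> PO" "C \<in> PO"
    and hom: "p0 \<in> hom P A" "p1 \<in> hom P B" "f \<in> hom A C" "g \<in> hom B C"
    and le: "\<And>w. w \<in> Field P \<Longrightarrow> (f (p0 w), g (p1 w)) \<in> C"
    using assms by (auto simp: lax_square_iff)
  have "(Tm A C f (Tm P A p0 w), Tm B C g (Tm P B p1 w)) \<in> To C" if "w \<in> Field (To P)" for w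
    using T_mono[OF obj(1,4) compose_Hom[OF hom(1,3)] compose_Hom[OF hom(2,4)] _ that]
      T_compose_app[OF obj(1,2,4) hom(1,3) that] T_compose_app[OF obj(1,3,4) hom(2,4) that]
    by (simp add: compose_eq le)
  then show ?thesis
    by (simp add: lax_square_iff obj hom T_Obj T_Hom)
qed

section \<open>From an extension to relations to the Beck-Chevalley condition\<close>

context
  fixes T'
  assumes T': "two_functor (RelPre small) (RelPre small) T'"
    and ext: "functor_eq (Pre small) (functor_comp T' diamond) (functor_comp diamond T)"
begin

lemma extension_Obj: "A \<in> PO \<Longrightarrow> onObj T' A = To A"
  using ext by (simp add: functor_eq_def functor_comp_def onObj_diamond)

lemma extension_diamond:
  "A \<in> PO \<Longrightarrow> B \<in> PO \<Longrightarrow> f \<in> hom A B \<Longrightarrow>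
    onHom T' A B (onHom diamond A B f) = onHom diamond (To A) (To B) (Tm A B f)"
  using ext by (simp add: functor_eq_def functor_comp_def onObj_diamond)

lemma extension_Hom:
  "A \<in> PO \<Longrightarrow> B \<in> PO \<Longrightarrow> R \<in> Rel A B \<Longrightarrow> onHom T' A B R \<in> Rel (To A) (To B)"
  using T' extension_Obj unfolding two_functor_def Obj_RelPre by metis

lemma extension_Idt: "A \<in> PO \<Longrightarrow> onHom T' A A A = To A"
  using T' extension_Obj by (simp add: two_functor_def Obj_RelPre RelPre_simps)

lemma extension_Comp:
  "A \<in> PO \<Longrightarrow> B \<in> PO \<Longrightarrow> C \<in> PO \<Longrightarrow> R \<in> Rel A B \<Longrightarrow> S \<in> Rel B C \<Longrightarrow>
    onHom T' A C (S O R) = onHom T' B C S O onHom T' A B R"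
  using T' unfolding two_functor_def Obj_RelPre RelPre_simps by blast

lemma extension_mono:
  "A \<in> PO \<Longrightarrow> B \<in> PO \<Longrightarrow> R \<in> Rel A B \<Longrightarrow> S \<in> Rel A B \<Longrightarrow> R \<subseteq> S \<Longrightarrow>
    onHom T' A B R \<subseteq> onHom T' A B S"
  using T' unfolding two_functor_def Obj_RelPre RelPre_simps by blast

text \<open>Right adjoints are unique, so an extension of \<open>T\<close> that is determined on left adjoints is
  determined on right adjoints as well.\<close>

lemma extension_codiamond:
  assumes A: "A \<in> PO" and B: "B \<in> PO" and f: "f \<in> hom A B"
  shows "onHom T' B A (codiamond A B f) = codiamond (To A) (To B) (Tm A B f)"
proof -
  let ?F = "onHom diamond (To A) (To B) (Tm A B f)"
  let ?G = "codiamond (To A) (To B) (Tm A B f)" and ?G' = "onHom T' B A (codiamond A B f)"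
  note dia = diamond_Hom[OF A B f] and codia = codiamond_Hom[OF A B f]
  note TA = T_Obj[OF A] and TB = T_Obj[OF B] and Tf = T_Hom[OF A B f]
  \<comment> \<open>\<open>T'\<close> preserves inclusions, identities and composites, so it carries
    the unit and the counit to inclusions that make \<open>?G'\<close> a right adjoint of
    \<open>?F\<close>.\<close>
  have unit': "To A \<subseteq> ?G' O ?F"
    using extension_mono[OF A A RelPre_Idt_Hom[OF A] RelPre_Comp_Hom[OF B dia codia]
        diamond_unit[OF A B f]]
    by (simp add: extension_Idt[OF A] extension_Comp[OF A B A dia codia] extension_diamond[OF A B f])
  have counit': "?F O ?G' \<subseteq> To B"
    using extension_mono[OF B B RelPre_Comp_Hom[OF A codia dia] RelPre_Idt_Hom[OF B]
        diamond_counit[OF B]]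
    by (simp add: extension_Idt[OF B] extension_Comp[OF B A B codia dia] extension_diamond[OF A B f])
  have G': "?G' \<in> Rel (To B) (To A)" by (rule extension_Hom[OF B A codia])
  have G: "?G \<in> Rel (To B) (To A)" by (rule codiamond_Hom[OF TA TB Tf])
  \<comment> \<open>G = 1 G \<subseteq> G' F G \<subseteq> G' 1 = G', with the unit of one
    adjunction and the counit of the other. Exchanging the two adjunctions gives the reverse
    inclusion.\<close>
  have "?G = To A O ?G" using RelPre_Idt_left[OF TB TA G] by simp
  also have "\<dots> \<subseteq> ?G' O (?F O ?G)" using unit' by blast
  also have "\<dots> \<subseteq> ?G' O To B" using diamond_counit[OF TB] by blast
  also have "\<dots> = ?G'" by (rule RelPre_Idt_right[OF TB TA G'])
  finally have 1: "?G \<subseteq> ?G'" .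
  have "?G' = To A O ?G'" using RelPre_Idt_left[OF TB TA G'] by simp
  also have "\<dots> \<subseteq> ?G O (?F O ?G')" using diamond_unit[OF TA TB Tf] by blast
  also have "\<dots> \<subseteq> ?G O To B" using counit' by blast
  also have "\<dots> = ?G" by (rule RelPre_Idt_right[OF TB TA G])
  finally show ?thesis using 1 by blast
qed

lemma extension_imp_exact: "preserves_exact_squares small T"
  unfolding preserves_exact_squares_def
proof (intro allI impI)
  fix P A B C p0 p1 f g
  assume ex: "exact_square small P A B C p0 p1 f g"
  then have lax: "lax_square small P A B C p0 p1 f g" by (simp add: exact_square_def)
  have obj: "P \<in> PO" "A \<in> PO" "B \<in> PO" "C \<in> PO"
    and hom: "p0 \<in> hom P A" "p1 \<in> hom P B" "f \<in> hom A C" "g \<in> hom B C"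
    using lax by (auto simp: lax_square_iff)
  \<comment> \<open>Exactness, written as an equation of relations, can be transported by
    \<open>T'\<close>. The image equation is then rewritten by the values of \<open>T'\<close> on
    left and right adjoints.\<close>
  have "onHom T' B A (codiamond A C f O onHom diamond B C g) =
      onHom T' B A (onHom diamond P A p0 O codiamond P B p1)"
    using ex exact_square_iff_rel[OF lax] by simp
  then have "codiamond (To A) (To C) (Tm A C f) O onHom diamond (To B) (To C) (Tm B C g) =
      onHom diamond (To P) (To A) (Tm P A p0) O codiamond (To P) (To B) (Tm P B p1)"
    by (simp add: obj hom diamond_Hom codiamond_Hom extension_diamond extension_codiamond
        extension_Comp[of B C A] extension_Comp[of B P A])
  then show "exact_square small (To P) (To A) (To B) (To C)
      (Tm P A p0) (Tm P B p1) (Tm A C f) (Tm B C g)"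
    using exact_square_iff_rel[OF T_lax_square[OF lax]] by simp
qed

end

end

section \<open>The lowerset doctrine inside a universe\<close>

locale pre_universe =
  fixes small :: "'u set \<Rightarrow> bool" and code :: "'u set \<Rightarrow> 'u"
  assumes universe: "universe small code"
begin

abbreviation "LO \<equiv> L_obj code"
abbreviation "Lm \<equiv> onHom (L small code)"
abbreviation "y \<equiv> yoneda code"
abbreviation "m \<equiv> mult small code"
abbreviation "dec \<equiv> decode small code"

lemma small_subset: "small X \<Longrightarrow> Y \<subseteq> X \<Longrightarrow> small Y"
  using universe unfolding universe_def by blast

lemma dec_code: "small X \<Longrightarrow> dec (code X) = X"
  using universe by (simp add: universe_def decode_def)

text \<open>Needed for \<open>dec_code\<close>: decoding is known to invert \<open>code\<close> on
  small sets.\<close>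

lemma small_lowerset: "A \<in> Obj (Pre small) \<Longrightarrow> W \<in> lowersets A \<Longrightarrow> small W"
  by (auto simp: in_Obj_iff lowersets_def intro: small_subset)

lemma Field_LO: "Field (LO A) = code ` lowersets A"
  unfolding Field_def L_obj_def by blast

lemma dec_lowerset: "A \<in> Obj (Pre small) \<Longrightarrow> w \<in> Field (LO A) \<Longrightarrow> dec w \<in> lowersets A"
  by (auto simp: Field_LO dec_code small_lowerset)

lemma code_dec: "A \<in> Obj (Pre small) \<Longrightarrow> w \<in> Field (LO A) \<Longrightarrow> code (dec w) = w"
  by (auto simp: Field_LO dec_code small_lowerset)

text \<open>Replaces inequalities between codes by inclusions of the lowersets they encode. With
  \<open>dec_eqI\<close> it reduces statements about \<open>LO A\<close> to statements about
  sets.\<close>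

lemma LO_iff:
  assumes "A \<in> Obj (Pre small)"
  shows "(v, w) \<in> LO A \<longleftrightarrow> v \<in> Field (LO A) \<and> w \<in> Field (LO A) \<and> dec v \<subseteq> dec w"
proof
  assume "(v, w) \<in> LO A"
  then obtain V W where "v = code V" "w = code W" "V \<in> lowersets A" "W \<in> lowersets A" "V \<subseteq> W"
    by (auto simp: L_obj_def)
  then show "v \<in> Field (LO A) \<and> w \<in> Field (LO A) \<and> dec v \<subseteq> dec w"
    using assms by (auto simp: Field_LO dec_code small_lowerset)
next
  assume "v \<in> Field (LO A) \<and> w \<in> Field (LO A) \<and> dec v \<subseteq> dec w"
  then show "(v, w) \<in> LO A"
    using dec_lowerset[OF assms] code_dec[OF assms] unfolding L_obj_def by (smt (verit) mem_Collect_eq)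
qed

lemma dec_eqI:
  "A \<in> Obj (Pre small) \<Longrightarrow> v \<in> Field (LO A) \<Longrightarrow> w \<in> Field (LO A) \<Longrightarrow> dec v = dec w \<Longrightarrow> v = w"
  by (metis code_dec)

lemma dec_Field: "A \<in> Obj (Pre small) \<Longrightarrow> w \<in> Field (LO A) \<Longrightarrow> a \<in> dec w \<Longrightarrow> a \<in> Field A"
  by (auto dest!: dec_lowerset simp: lowersets_def)

lemma dec_down:
  "A \<in> Obj (Pre small) \<Longrightarrow> w \<in> Field (LO A) \<Longrightarrow> a \<in> dec w \<Longrightarrow> (a', a) \<in> A \<Longrightarrow> a' \<in> dec w"
  by (auto dest!: dec_lowerset simp: lowersets_def)

text \<open>Smallness comes from closure of the universe under power sets: the carrier lies in the
  coded power set of \<open>Field A\<close>.\<close>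

lemma LO_Obj:
  assumes "A \<in> Obj (Pre small)"
  shows "LO A \<in> Obj (Pre small)"
proof -
  have "small (code ` Pow (Field A))"
    using assms universe by (simp add: in_Obj_iff universe_def)
  then have "small (Field (LO A))"
    by (rule small_subset) (auto simp: Field_LO lowersets_def)
  moreover have "Preorder (LO A)"
    unfolding preorder_on_def refl_on_def trans_def
  proof (intro conjI)
    show "LO A \<subseteq> Field (LO A) \<times> Field (LO A)"
      by (auto intro: FieldI1 FieldI2)
  qed (use LO_iff[OF assms] in blast)+
  ultimately show ?thesis by (simp add: in_Obj_iff)
qed

lemma onObj_L: "onObj (L small code) A = LO A"
  by (simp add: L_def)

lemma principal_lowerset: "A \<in> Obj (Pre small) \<Longrightarrow> {a'. (a', a) \<in> A} \<in> lowersets A"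
  unfolding lowersets_def by (auto intro: FieldI1 Obj_trans)

lemma y_Field: "A \<in> Obj (Pre small) \<Longrightarrow> a \<in> Field A \<Longrightarrow> y A a \<in> Field (LO A)"
  by (auto simp: yoneda_def Field_LO principal_lowerset)

lemma dec_y: "A \<in> Obj (Pre small) \<Longrightarrow> a \<in> Field A \<Longrightarrow> dec (y A a) = {a'. (a', a) \<in> A}"
  by (simp add: yoneda_def dec_code small_lowerset[OF _ principal_lowerset])

text \<open>The Yoneda lemma for presheaves with values in truth values: reflexivity puts
  \<open>a\<close> into its principal lowerset, and down-closure of \<open>dec w\<close> gives the
  converse.\<close>

lemma y_le_iff:
  assumes "A \<in> Obj (Pre small)" "a \<in> Field A" "w \<in> Field (LO A)"
  shows "(y A a, w) \<in> LO A \<longleftrightarrow> a \<in> dec w"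
  using assms Obj_refl[OF assms(1,2)] dec_down[OF assms(1,3)]
  by (auto simp: LO_iff y_Field dec_y)

lemma y_Hom:
  assumes "A \<in> Obj (Pre small)"
  shows "y A \<in> Hom (Pre small) A (LO A)"
proof (rule HomI)
  show "y A \<in> extensional (Field A)" by (simp add: yoneda_def)
  show "(y A a, y A a') \<in> LO A" if "(a, a') \<in> A" for a a'
    using that assms by (simp add: y_le_iff y_Field dec_y FieldI1[OF that] FieldI2[OF that])
qed (use assms in \<open>simp add: y_Field\<close>)

lemma image_lowerset: "C \<in> Obj (Pre small) \<Longrightarrow> {c. \<exists>a\<in>X. (c, f a) \<in> C} \<in> lowersets C"
  unfolding lowersets_def by (auto intro: FieldI1 dest: Obj_trans)

lemma Lm_Field:
  "C \<in> Obj (Pre small) \<Longrightarrow> w \<in> Field (LO A) \<Longrightarrow> Lm A C f w \<in> Field (LO C)"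
  by (simp add: L_def Field_LO[of C] image_lowerset)

lemma dec_Lm:
  "C \<in> Obj (Pre small) \<Longrightarrow> w \<in> Field (LO A) \<Longrightarrow> dec (Lm A C f w) = {c. \<exists>a\<in>dec w. (c, f a) \<in> C}"
  by (simp add: L_def dec_code small_lowerset[OF _ image_lowerset])

lemma Lm_Hom:
  assumes "A \<in> Obj (Pre small)" "C \<in> Obj (Pre small)"
  shows "Lm A C f \<in> Hom (Pre small) (LO A) (LO C)"
proof (rule HomI)
  show "Lm A C f \<in> extensional (Field (LO A))" by (simp add: L_def)
  show "(Lm A C f v, Lm A C f w) \<in> LO C" if "(v, w) \<in> LO A" for v w
    using that assms by (auto simp: LO_iff Lm_Field dec_Lm)
qed (use assms in \<open>simp add: Lm_Field\<close>)

lemma Union_lowerset: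
  assumes "A \<in> Obj (Pre small)" "w \<in> Field (LO (LO A))"
  shows "(\<Union>v\<in>dec w. dec v) \<in> lowersets A"
proof -
  have "dec v \<in> lowersets A" if "v \<in> dec w" for v
    using that assms by (blast intro: dec_lowerset dec_Field LO_Obj)
  then show ?thesis unfolding lowersets_def by blast
qed

lemma m_Field: "A \<in> Obj (Pre small) \<Longrightarrow> w \<in> Field (LO (LO A)) \<Longrightarrow> m A w \<in> Field (LO A)"
  unfolding Field_LO[of A] by (simp add: mult_def Union_lowerset)

lemma dec_m: "A \<in> Obj (Pre small) \<Longrightarrow> w \<in> Field (LO (LO A)) \<Longrightarrow> dec (m A w) = (\<Union>v\<in>dec w. dec v)"
  by (simp add: mult_def dec_code small_lowerset[OF _ Union_lowerset])

lemma m_Hom: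
  assumes "A \<in> Obj (Pre small)"
  shows "m A \<in> Hom (Pre small) (LO (LO A)) (LO A)"
proof (rule HomI)
  show "m A \<in> extensional (Field (LO (LO A)))" by (simp add: mult_def)
  show "(m A v, m A w) \<in> LO A" if "(v, w) \<in> LO (LO A)" for v w
    using that assms by (auto simp: LO_iff LO_Obj m_Field dec_m)
qed (use assms in \<open>simp add: m_Field\<close>)

section \<open>Three exact squares, one for each axiom of a distributive law\<close>

text \<open>Exactness here says that \<open>y A\<close> reflects the order. Its image under a
  functor that preserves exact squares gives the unit axiom.\<close>

lemma exact_square_yoneda:
  assumes A: "A \<in> Obj (Pre small)"
  shows "exact_square small A A A (LO A) (restrict (\<lambda>a. a) (Field A)) (restrict (\<lambda>a. a) (Field A))
    (y A) (y A)"
proof -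
  have "(y A a, y A a) \<in> LO A" if "a \<in> Field A" for a
    using A that by (simp add: y_le_iff y_Field dec_y Obj_refl)
  moreover have "(y A a, y A b) \<in> LO A \<longleftrightarrow> (\<exists>w\<in>Field A. (a, w) \<in> A \<and> (w, b) \<in> A)"
    if "a \<in> Field A" "b \<in> Field A" for a b
    using A that Obj_trans[OF A] Obj_refl[OF A] by (auto simp: y_le_iff y_Field dec_y)
  ultimately show ?thesis
    using A by (simp add: exact_square_def lax_square_iff LO_Obj y_Hom id_Hom)
qed

text \<open>By the Yoneda lemma the exactness formula is the definition of the direct image
  \<open>Lm A B f\<close>. The image of this square gives naturality.\<close>

lemma exact_square_naturality:
  assumes A: "A \<in> Obj (Pre small)" and B: "B \<in> Obj (Pre small)" and f: "f \<in> Hom (Pre small) A B"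
  shows "exact_square small A B (LO A) (LO B) f (y A) (y B) (Lm A B f)"
proof -
  have iff: "(y B b, Lm A B f w) \<in> LO B \<longleftrightarrow> (\<exists>a\<in>Field A. (b, f a) \<in> B \<and> (y A a, w) \<in> LO A)"
    if "b \<in> Field B" "w \<in> Field (LO A)" for b w
    using A B that dec_Field[OF A that(2)] by (auto simp: y_le_iff Lm_Field dec_Lm)
  moreover have "(y B (f a), Lm A B f (y A a)) \<in> LO B" if "a \<in> Field A" for a
    using A B that Hom_Field[OF f that] by (auto simp: iff y_Field y_le_iff dec_y intro: Obj_refl)
  ultimately show ?thesis
    using A B f by (simp add: exact_square_def lax_square_iff LO_Obj y_Hom Lm_Hom)
qed

text \<open>The union of a down-closed family is already the union of the principal lowersets in it,
  so \<open>A\<close> suffices as apex. The image of this square gives the multiplication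
  axiom.\<close>

lemma exact_square_mult:
  assumes A: "A \<in> Obj (Pre small)"
  shows "exact_square small A A (LO (LO A)) (LO A) (restrict (\<lambda>a. a) (Field A))
    (compose (Field A) (y (LO A)) (y A)) (y A) (m A)"
proof -
  note LA = LO_Obj[OF A]
  have iff: "(y A a, m A w) \<in> LO A \<longleftrightarrow>
      (\<exists>a'\<in>Field A. (a, a') \<in> A \<and> (y (LO A) (y A a'), w) \<in> LO (LO A))"
    if a: "a \<in> Field A" and w: "w \<in> Field (LO (LO A))" for a w
  proof -
    have "(y A a, m A w) \<in> LO A \<longleftrightarrow> (\<exists>v\<in>dec w. a \<in> dec v)"
      using A a w by (simp add: y_le_iff m_Field dec_m)
    also have "\<dots> \<longleftrightarrow> (\<exists>a'\<in>Field A. (a, a') \<in> A \<and> y A a' \<in> dec w)"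
    proof
      assume "\<exists>v\<in>dec w. a \<in> dec v"
      then obtain v where v: "v \<in> dec w" "a \<in> dec v" by blast
      then have "(y A a, v) \<in> LO A" using A a w by (simp add: y_le_iff dec_Field[OF LA w])
      \<comment> \<open>\<open>dec w\<close> is down-closed and contains \<open>v\<close>, which
        lies above the principal lowerset of \<open>a\<close>; so \<open>a\<close> itself serves as
        \<open>a'\<close>.\<close>
      then have "y A a \<in> dec w" using dec_down[OF LA w] v by blast
      then show "\<exists>a'\<in>Field A. (a, a') \<in> A \<and> y A a' \<in> dec w" using a Obj_refl[OF A a] by blast
    next
      assume "\<exists>a'\<in>Field A. (a, a') \<in> A \<and> y A a' \<in> dec w"
      then obtain a' where "a' \<in> Field A" "(a, a') \<in> A" "y A a' \<in> dec w" by blast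
      \<comment> \<open>The witness is the principal lowerset \<open>y A a'\<close>, which contains
        \<open>a\<close> because a \<le> a'.\<close>
      then show "\<exists>v\<in>dec w. a \<in> dec v" using dec_y[OF A] by blast
    qed
    also have "\<dots> \<longleftrightarrow> (\<exists>a'\<in>Field A. (a, a') \<in> A \<and> (y (LO A) (y A a'), w) \<in> LO (LO A))"
      using A LA w by (simp add: y_le_iff y_Field)
    finally show ?thesis .
  qed
  have "(y A a, m A (y (LO A) (y A a))) \<in> LO A" if "a \<in> Field A" for a
    using A LA that by (auto simp: iff y_Field y_le_iff dec_y intro!: bexI[of _ a] Obj_refl)
  then show ?thesis
    using A LA by (simp add: exact_square_def lax_square_iff LO_Obj y_Hom m_Hom id_Hom compose_eq
        iff compose_Hom[OF y_Hom y_Hom])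
qed

section \<open>Relations as Kleisli maps\<close>

text \<open>\<open>rel\<close> and \<open>name\<close> are the two directions of the isomorphism between \<open>Rel(Pre)\<close> and the
  Kleisli category of \<open>L\<close>.\<close>

definition rel :: "'u rel \<Rightarrow> ('u \<Rightarrow> 'u) \<Rightarrow> 'u rel" where
  "rel A r = {(b, a). a \<in> Field A \<and> b \<in> dec (r a)}"

definition name :: "'u rel \<Rightarrow> 'u rel \<Rightarrow> 'u \<Rightarrow> 'u" where
  "name A R = (\<lambda>a\<in>Field A. code {b. (b, a) \<in> R})"

lemma name_lowerset:
  assumes "A \<in> Obj (Pre small)" "R \<in> Hom (RelPre small) A B"
  shows "{b. (b, a) \<in> R} \<in> lowersets B"
proof -
  have R: "R \<subseteq> Field B \<times> Field A"
    and sat: "\<And>b b' a a'. (b', b) \<in> B \<Longrightarrow> (a, a') \<in> A \<Longrightarrow> (b, a) \<in> R \<Longrightarrow> (b', a') \<in> R"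
    using assms(2) unfolding Hom_RelPre by blast+
  have "(b', a) \<in> R" if "(b, a) \<in> R" "(b', b) \<in> B" for b b'
    using sat[OF that(2) Obj_refl[OF assms(1)] that(1)] R that(1) by blast
  then show ?thesis using R by (auto simp: lowersets_def)
qed

lemma dec_name:
  assumes "A \<in> Obj (Pre small)" "B \<in> Obj (Pre small)" "R \<in> Hom (RelPre small) A B" "a \<in> Field A"
  shows "dec (name A R a) = {b. (b, a) \<in> R}"
  using assms by (simp add: name_def dec_code small_lowerset[OF _ name_lowerset])

lemma name_Hom:
  assumes A: "A \<in> Obj (Pre small)" and B: "B \<in> Obj (Pre small)" and R: "R \<in> Hom (RelPre small) A B"
  shows "name A R \<in> Hom (Pre small) A (LO B)"
proof (rule HomI)
  show "name A R \<in> extensional (Field A)" by (simp add: name_def)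
  show field: "name A R a \<in> Field (LO B)" if "a \<in> Field A" for a
    using that by (simp add: name_def Field_LO name_lowerset[OF A R])
  show "(name A R a, name A R a') \<in> LO B" if "(a, a') \<in> A" for a a'
  proof -
    have "{b. (b, a) \<in> R} \<subseteq> {b. (b, a') \<in> R}"
      using R that Obj_refl[OF B] unfolding Hom_RelPre by blast
    then show ?thesis
      using field dec_name[OF A B R] FieldI1[OF that] FieldI2[OF that] by (simp add: LO_iff[OF B])
  qed
qed

lemma rel_name:
  assumes "A \<in> Obj (Pre small)" "B \<in> Obj (Pre small)" "R \<in> Hom (RelPre small) A B"
  shows "rel A (name A R) = R"
  using assms dec_name[OF assms] by (auto simp: rel_def Hom_RelPre)

lemma rel_Hom:
  assumes "A \<in> Obj (Pre small)" "B \<in> Obj (Pre small)" "r \<in> Hom (Pre small) A (LO B)"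
  shows "rel A r \<in> Hom (RelPre small) A B"
  unfolding Hom_RelPre
proof (intro conjI allI impI)
  show "rel A r \<subseteq> Field B \<times> Field A"
    using dec_Field[OF assms(2) Hom_Field[OF assms(3)]] by (auto simp: rel_def)
  show "(b', a') \<in> rel A r" if "(b', b) \<in> B \<and> (a, a') \<in> A \<and> (b, a) \<in> rel A r" for b b' a a'
  proof -
    have "(r a, r a') \<in> LO B" using Hom_mono[OF assms(3)] that by blast
    then show ?thesis
      using that assms(2) dec_down[OF assms(2)] FieldI2[of a a' A] by (auto simp: rel_def LO_iff)
  qed
qed

text \<open>A lowerset is determined by its members. With \<open>rel_name\<close> this makes
  \<open>rel\<close> and \<open>name\<close> inverse bijections between maps from \<open>A\<close>
  to \<open>LO B\<close> and 1-cells from \<open>A\<close> to \<open>B\<close>.\<close>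

lemma rel_inj:
  assumes "A \<in> Obj (Pre small)" "B \<in> Obj (Pre small)"
    and r: "r \<in> Hom (Pre small) A (LO B)" and s: "s \<in> Hom (Pre small) A (LO B)"
    and "rel A r = rel A s"
  shows "r = s"
proof (rule Hom_eqI[OF r s])
  fix a assume a: "a \<in> Field A"
  then have "dec (r a) = dec (s a)" using assms(5) by (auto simp: rel_def set_eq_iff)
  then show "r a = s a" using dec_eqI[OF assms(2) Hom_Field[OF r a] Hom_Field[OF s a]] by blast
qed

text \<open>Identifies the functor \<open>diamond\<close> with the canonical functor into the
  Kleisli category, which sends f to the composite of f with the unit.\<close>

lemma rel_y:
  assumes "B \<in> Obj (Pre small)" "f \<in> Hom (Pre small) A B"
  shows "rel A (compose (Field A) (y B) f) = onHom diamond A B f"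
  using assms Hom_Field[OF assms(2)] by (auto simp: rel_def onHom_diamond compose_eq dec_y)

text \<open>Kleisli composition forms the union of the sets \<open>dec (s b)\<close> over
  \<open>b\<close> in \<open>dec (r a)\<close>, which is relational composition.\<close>

lemma rel_kleisli:
  assumes A: "A \<in> Obj (Pre small)" and B: "B \<in> Obj (Pre small)" and C: "C \<in> Obj (Pre small)"
    and r: "r \<in> Hom (Pre small) A (LO B)" and s: "s \<in> Hom (Pre small) B (LO C)"
  shows "rel A (compose (Field A) (m C) (compose (Field A) (Lm B (LO C) s) r)) = rel B s O rel A r"
proof -
  note LC = LO_Obj[OF C]
  have "dec (m C (Lm B (LO C) s (r a))) = {c. \<exists>b\<in>dec (r a). c \<in> dec (s b)}" if a: "a \<in> Field A" for a
  proof -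
    have ra: "r a \<in> Field (LO B)" using Hom_Field[OF r a] .
    have sb: "s b \<in> Field (LO C)" if "b \<in> dec (r a)" for b
      using that Hom_Field[OF s] dec_Field[OF B ra] by blast
    have "dec (m C (Lm B (LO C) s (r a))) = (\<Union>v\<in>{v. \<exists>b\<in>dec (r a). (v, s b) \<in> LO C}. dec v)"
      by (simp add: dec_m[OF C] Lm_Field[OF LC ra] dec_Lm[OF LC ra])
    \<comment> \<open>Each \<open>v\<close> below \<open>s b\<close> is contained in it, and
      \<open>s b\<close> is itself such a \<open>v\<close>.\<close>
    also have "\<dots> = {c. \<exists>b\<in>dec (r a). c \<in> dec (s b)}"
      using sb by (auto simp: LO_iff[OF C])
    finally show ?thesis .
  qed
  then show ?thesis
    using dec_Field[OF B Hom_Field[OF r]]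
    by (auto simp: rel_def compose_eq relcomp_unfold) blast
qed

end

section \<open>The canonical candidate for a distributive law\<close>

locale pre_endo = pre_universe small code + pre_two_functor small T
  for small :: "'u set \<Rightarrow> bool" and code and T
begin

text \<open>As a relation this is the right adjoint of the diamond of T y. The formula is forced by
  an extension: the identity map on \<open>LO A\<close> corresponds to the membership relation,
  which by the Yoneda lemma is the right adjoint of the diamond of \<open>y A\<close>.\<close>

definition canonical_law :: "'u rel \<Rightarrow> 'u \<Rightarrow> 'u" where
  "canonical_law A = (\<lambda>w\<in>Field (To (LO A)).
     code {a \<in> Field (To A). (Tm A (LO A) (y A) a, w) \<in> To (LO A)})"

lemma canonical_lowerset:
  assumes A: "A \<in> PO"
  shows "{a \<in> Field (To A). (Tm A (LO A) (y A) a, w) \<in> To (LO A)} \<in> lowersets (To A)"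
  unfolding lowersets_def
  by (auto intro: FieldI1)
    (meson Hom_mono T_Hom[OF A LO_Obj[OF A] y_Hom[OF A]] Obj_trans T_Obj[OF LO_Obj[OF A]])

lemma canonical_Field:
  "A \<in> PO \<Longrightarrow> w \<in> Field (To (LO A)) \<Longrightarrow> canonical_law A w \<in> Field (LO (To A))"
  by (simp add: canonical_law_def Field_LO[of "To A"] canonical_lowerset)

lemma dec_canonical:
  "A \<in> PO \<Longrightarrow> w \<in> Field (To (LO A)) \<Longrightarrow>
    dec (canonical_law A w) = {a \<in> Field (To A). (Tm A (LO A) (y A) a, w) \<in> To (LO A)}"
  by (simp add: canonical_law_def dec_code small_lowerset[OF T_Obj canonical_lowerset])

lemma canonical_Hom:
  assumes A: "A \<in> PO"
  shows "canonical_law A \<in> hom (To (LO A)) (LO (To A))"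
proof (rule HomI)
  show "canonical_law A \<in> extensional (Field (To (LO A)))" by (simp add: canonical_law_def)
  show "(canonical_law A v, canonical_law A w) \<in> LO (To A)" if "(v, w) \<in> To (LO A)" for v w
    using A FieldI1[OF that] FieldI2[OF that] Obj_trans[OF T_Obj[OF LO_Obj[OF A]] _ that]
    by (auto simp: LO_iff T_Obj canonical_Field dec_canonical)
qed (use A in \<open>simp add: canonical_Field\<close>)

section \<open>From the Beck-Chevalley condition to a distributive law\<close>

context
  assumes BC: "preserves_exact_squares small T"
begin

lemma T_exact:
  assumes "exact_square small P A B C p0 p1 f g" "a \<in> Field (To A)" "b \<in> Field (To B)"
  shows "(Tm A C f a, Tm B C g b) \<in> To C \<longleftrightarrow>
    (\<exists>w\<in>Field (To P). (a, Tm P A p0 w) \<in> To A \<and> (Tm P B p1 w, b) \<in> To B)"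
  using BC assms unfolding preserves_exact_squares_def exact_square_def by blast

text \<open>The image of \<open>exact_square_yoneda\<close> says that T y reflects the order, so the
  elements whose image lies below T y a are those below \<open>a\<close>.\<close>

lemma canonical_unit:
  assumes A: "A \<in> PO" and a: "a \<in> Field (To A)"
  shows "canonical_law A (Tm A (LO A) (y A) a) = y (To A) a"
proof (rule dec_eqI)
  note Ty = Hom_Field[OF T_Hom[OF A LO_Obj[OF A] y_Hom[OF A]]]
  show "To A \<in> PO" using A by (rule T_Obj)
  show "canonical_law A (Tm A (LO A) (y A) a) \<in> Field (LO (To A))" "y (To A) a \<in> Field (LO (To A))"
    using A a Ty by (simp_all add: canonical_Field y_Field T_Obj)
  have "(Tm A (LO A) (y A) a', Tm A (LO A) (y A) a) \<in> To (LO A) \<longleftrightarrow> (a', a) \<in> To A"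
    if "a' \<in> Field (To A)" for a'
    using T_exact[OF exact_square_yoneda[OF A] that a] that a
      Obj_refl[OF T_Obj[OF A]] Obj_trans[OF T_Obj[OF A]] by (auto simp: T_Idt[OF A])
  then show "dec (canonical_law A (Tm A (LO A) (y A) a)) = dec (y (To A) a)"
    using A a Ty by (auto simp: dec_canonical dec_y T_Obj intro: FieldI1)
qed

text \<open>After decoding, the two sides are the two sides of the exactness formula for the image
  of \<open>exact_square_naturality\<close>.\<close>

lemma canonical_natural:
  assumes A: "A \<in> PO" and B: "B \<in> PO" and f: "f \<in> hom A B" and w: "w \<in> Field (To (LO A))"
  shows "canonical_law B (Tm (LO A) (LO B) (Lm A B f) w) =
    Lm (To A) (To B) (Tm A B f) (canonical_law A w)"
proof (rule dec_eqI)
  note TLf = Hom_Field[OF T_Hom[OF LO_Obj[OF A] LO_Obj[OF B] Lm_Hom[OF A B]] w]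
  note lw = canonical_Field[OF A w]
  show "To B \<in> PO" using B by (rule T_Obj)
  show "canonical_law B (Tm (LO A) (LO B) (Lm A B f) w) \<in> Field (LO (To B))"
    "Lm (To A) (To B) (Tm A B f) (canonical_law A w) \<in> Field (LO (To B))"
    using B TLf lw by (simp_all add: canonical_Field Lm_Field T_Obj)
  show "dec (canonical_law B (Tm (LO A) (LO B) (Lm A B f) w)) =
      dec (Lm (To A) (To B) (Tm A B f) (canonical_law A w))"
    using T_exact[OF exact_square_naturality[OF A B f] _ w]
    by (auto simp: dec_canonical[OF B TLf] dec_Lm[OF T_Obj[OF B] lw] dec_canonical[OF A w]
        intro: FieldI1)
qed

text \<open>Both sides decode to the set of those \<open>a\<close> for which some \<open>v\<close>
  satisfies \<open>?yA a\<close> \<le> \<open>v\<close> and \<open>?yLA v\<close> \<le>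
  \<open>w\<close>. On the left this uses the image of \<open>exact_square_mult\<close>, on the
  right the description of direct image and union.\<close>

lemma canonical_mult:
  assumes A: "A \<in> PO" and w: "w \<in> Field (To (LO (LO A)))"
  shows "canonical_law A (Tm (LO (LO A)) (LO A) (m A) w) =
    m (To A) (Lm (To (LO A)) (LO (To A)) (canonical_law A) (canonical_law (LO A) w))"
proof (rule dec_eqI)
  note LA = LO_Obj[OF A]
  note LLA = LO_Obj[OF LA] and TA = T_Obj[OF A] and TLA = T_Obj[OF LA]
  note LTA = LO_Obj[OF TA]
  note TLLA = T_Obj[OF LLA]
  note Tm_w = Hom_Field[OF T_Hom[OF LLA LA m_Hom[OF A]] w]
  note lw = canonical_Field[OF LA w]
  note TyA = T_Hom[OF A LA y_Hom[OF A]] and TyLA = T_Hom[OF LA LLA y_Hom[OF LA]]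
  let ?yA = "Tm A (LO A) (y A)" and ?yLA = "Tm (LO A) (LO (LO A)) (y (LO A))"
  show "To A \<in> PO" by (rule TA)
  show "canonical_law A (Tm (LO (LO A)) (LO A) (m A) w) \<in> Field (LO (To A))"
    by (rule canonical_Field[OF A Tm_w])
  have Llw: "Lm (To (LO A)) (LO (To A)) (canonical_law A) (canonical_law (LO A) w)
      \<in> Field (LO (LO (To A)))" by (rule Lm_Field[OF LTA lw])
  show "m (To A) (Lm (To (LO A)) (LO (To A)) (canonical_law A) (canonical_law (LO A) w))
      \<in> Field (LO (To A))" by (rule m_Field[OF TA Llw])
  have yA: "?yA a \<in> Field (To (LO A))" if "a \<in> Field (To A)" for a
    using Hom_Field[OF TyA that] .
  have "a \<in> dec (canonical_law A (Tm (LO (LO A)) (LO A) (m A) w)) \<longleftrightarrow>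
      (\<exists>v\<in>Field (To (LO A)). a \<in> Field (To A) \<and> (?yA a, v) \<in> To (LO A) \<and>
        (?yLA v, w) \<in> To (LO (LO A)))" for a
  proof (cases "a \<in> Field (To A)")
    case True
    have "a \<in> dec (canonical_law A (Tm (LO (LO A)) (LO A) (m A) w)) \<longleftrightarrow>
        (\<exists>a'\<in>Field (To A). (a, a') \<in> To A \<and> (?yLA (?yA a'), w) \<in> To (LO (LO A)))"
      using T_exact[OF exact_square_mult[OF A] True w] True
      by (simp add: dec_canonical[OF A Tm_w] T_Idt[OF A]
          T_compose_app[OF A LA LLA y_Hom[OF A] y_Hom[OF LA]])
    \<comment> \<open>Given \<open>a'\<close>, take \<open>?yA a'\<close> for \<open>v\<close>.
      Given \<open>v\<close>, take \<open>a\<close> for \<open>a'\<close>, since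
      \<open>?yLA (?yA a)\<close> \<le> \<open>?yLA v\<close> \<le> \<open>w\<close>.\<close>
    also have "\<dots> \<longleftrightarrow> (\<exists>v\<in>Field (To (LO A)). (?yA a, v) \<in> To (LO A) \<and> (?yLA v, w) \<in> To (LO (LO A)))"
      using Hom_mono[OF TyA] yA Hom_mono[OF TyLA] Obj_trans[OF TLLA] Obj_refl[OF TA True] True
      by meson
    finally show ?thesis using True by simp
  qed (simp add: dec_canonical[OF A Tm_w])
  moreover have "a \<in> dec (m (To A) (Lm (To (LO A)) (LO (To A)) (canonical_law A) (canonical_law (LO A) w)))
      \<longleftrightarrow> (\<exists>v\<in>Field (To (LO A)). a \<in> Field (To A) \<and> (?yA a, v) \<in> To (LO A) \<and>
        (?yLA v, w) \<in> To (LO (LO A)))" for a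
  proof -
    have "a \<in> dec (m (To A) (Lm (To (LO A)) (LO (To A)) (canonical_law A) (canonical_law (LO A) w)))
        \<longleftrightarrow> (\<exists>u v. v \<in> dec (canonical_law (LO A) w) \<and> (u, canonical_law A v) \<in> LO (To A) \<and> a \<in> dec u)"
      by (auto simp: dec_m[OF TA Llw] dec_Lm[OF LTA lw])
    \<comment> \<open>The largest choice of \<open>u\<close> is \<open>canonical_law A v\<close>
      itself.\<close>
    also have "\<dots> \<longleftrightarrow> (\<exists>v. v \<in> dec (canonical_law (LO A) w) \<and> a \<in> dec (canonical_law A v))"
      using canonical_Field[OF A] dec_Field[OF TLA lw] by (auto simp: LO_iff[OF TA])
    finally show ?thesis
      by (auto simp: dec_canonical[OF A] dec_canonical[OF LA w])
  qed
  ultimately show "dec (canonical_law A (Tm (LO (LO A)) (LO A) (m A) w)) =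
      dec (m (To A) (Lm (To (LO A)) (LO (To A)) (canonical_law A) (canonical_law (LO A) w)))"
    by blast
qed

end

text \<open>Composites are restricted to the carrier of their domain, so each equation of maps is a
  pointwise equation on that carrier.\<close>

lemma distributive_law_iff:
  "distributive_law (Pre small) T (L small code) y m \<Lambda> \<longleftrightarrow>
     (\<forall>A\<in>PO. \<Lambda> A \<in> hom (To (LO A)) (LO (To A))) \<and>
     (\<forall>A\<in>PO. \<forall>B\<in>PO. \<forall>f\<in>hom A B. \<forall>w\<in>Field (To (LO A)).
        \<Lambda> B (Tm (LO A) (LO B) (Lm A B f) w) = Lm (To A) (To B) (Tm A B f) (\<Lambda> A w)) \<and>
     (\<forall>A\<in>PO. \<forall>a\<in>Field (To A). \<Lambda> A (Tm A (LO A) (y A) a) = y (To A) a) \<and>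
     (\<forall>A\<in>PO. \<forall>w\<in>Field (To (LO (LO A))). \<Lambda> A (Tm (LO (LO A)) (LO A) (m A) w) =
        m (To A) (Lm (To (LO A)) (LO (To A)) (\<Lambda> A) (\<Lambda> (LO A) w)))"
proof -
  have ext: "compose S g f = compose S k h \<longleftrightarrow> (\<forall>x\<in>S. g (f x) = k (h x))"
    for S :: "'u set" and f g h k :: "'u \<Rightarrow> 'u"
    by (auto simp: compose_def restrict_def fun_eq_iff)
  \<comment> \<open>The unit axiom compares a composite with \<open>y\<close>, which is restricted
    to the carrier by its own definition.\<close>
  have ext_y: "compose (Field A) g f = y A \<longleftrightarrow> (\<forall>x\<in>Field A. g (f x) = y A x)"
    for A and f g :: "'u \<Rightarrow> 'u"
    by (auto simp: compose_def restrict_def fun_eq_iff yoneda_def)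
  show ?thesis
    unfolding distributive_law_def natural_transformation_def Let_def Comp_Pre functor_comp_def
    by (simp add: onObj_L ext ext_y compose_eq cong: ball_cong) blast
qed

lemma exact_imp_distributive_law:
  assumes "preserves_exact_squares small T"
  shows "distributive_law (Pre small) T (L small code) y m canonical_law"
  using assms
  by (simp add: distributive_law_iff canonical_Hom canonical_natural canonical_unit canonical_mult)

section \<open>From a distributive law to an extension to relations\<close>

definition kleisli_extension :: "('u rel \<Rightarrow> 'u \<Rightarrow> 'u) \<Rightarrow> ('u rel, 'u rel, 'u rel, 'u rel) functor_data" where
  "kleisli_extension \<Lambda> =
     \<lparr>onObj = To,
      onHom = (\<lambda>A B R. rel (To A) (compose (Field (To A)) (\<Lambda> B) (Tm A (LO B) (name A R))))\<rparr>"

context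
  fixes \<Lambda>
  assumes law: "distributive_law (Pre small) T (L small code) y m \<Lambda>"
begin

lemma
  shows law_Hom: "A \<in> PO \<Longrightarrow> \<Lambda> A \<in> hom (To (LO A)) (LO (To A))"
    and law_natural: "A \<in> PO \<Longrightarrow> B \<in> PO \<Longrightarrow> f \<in> hom A B \<Longrightarrow> w \<in> Field (To (LO A)) \<Longrightarrow>
      \<Lambda> B (Tm (LO A) (LO B) (Lm A B f) w) = Lm (To A) (To B) (Tm A B f) (\<Lambda> A w)"
    and law_unit: "A \<in> PO \<Longrightarrow> a \<in> Field (To A) \<Longrightarrow> \<Lambda> A (Tm A (LO A) (y A) a) = y (To A) a"
    and law_mult: "A \<in> PO \<Longrightarrow> w \<in> Field (To (LO (LO A))) \<Longrightarrow>
      \<Lambda> A (Tm (LO (LO A)) (LO A) (m A) w) =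
      m (To A) (Lm (To (LO A)) (LO (To A)) (\<Lambda> A) (\<Lambda> (LO A) w))"
  using law unfolding distributive_law_iff by blast+

lemma kleisli_Hom:
  assumes "A \<in> PO" "B \<in> PO" "r \<in> hom A (LO B)"
  shows "compose (Field (To A)) (\<Lambda> B) (Tm A (LO B) r) \<in> hom (To A) (LO (To B))"
  using assms by (blast intro: compose_Hom T_Hom law_Hom LO_Obj)

text \<open>As \<open>name\<close> inverts \<open>rel\<close>, the extension can be computed on any
  Kleisli map without passing through \<open>name\<close>.\<close>

lemma kleisli_extension_rel:
  assumes A: "A \<in> PO" and B: "B \<in> PO" and r: "r \<in> hom A (LO B)"
  shows "onHom (kleisli_extension \<Lambda>) A B (rel A r) =
    rel (To A) (compose (Field (To A)) (\<Lambda> B) (Tm A (LO B) r))"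
proof -
  have "name A (rel A r) = r"
    by (rule rel_inj[OF A B name_Hom[OF A B rel_Hom[OF A B r]] r])
      (rule rel_name[OF A B rel_Hom[OF A B r]])
  then show ?thesis by (simp add: kleisli_extension_def)
qed

text \<open>The relation of f has Kleisli map y f, and \<Lambda> T(y f) = \<Lambda> (T y) (T f) = y
  (T f) by the unit axiom.\<close>

lemma kleisli_extension_diamond:
  assumes A: "A \<in> PO" and B: "B \<in> PO" and f: "f \<in> hom A B"
  shows "onHom (kleisli_extension \<Lambda>) A B (onHom diamond A B f) =
    onHom diamond (To A) (To B) (Tm A B f)"
proof -
  note LB = LO_Obj[OF B]
  have "onHom (kleisli_extension \<Lambda>) A B (onHom diamond A B f) = rel (To A)
      (compose (Field (To A)) (\<Lambda> B) (Tm A (LO B) (compose (Field A) (y B) f)))"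
    using kleisli_extension_rel[OF A B compose_Hom[OF f y_Hom[OF B]]] rel_y[OF B f] by simp
  also have "compose (Field (To A)) (\<Lambda> B) (Tm A (LO B) (compose (Field A) (y B) f)) =
      compose (Field (To A)) (y (To B)) (Tm A B f)"
    using Hom_Field[OF T_Hom[OF A B f]]
    by (intro extensionalityI[OF compose_extensional compose_extensional])
      (simp add: compose_eq T_compose_app[OF A B LB f y_Hom[OF B]] law_unit[OF B])
  also have "rel (To A) \<dots> = onHom diamond (To A) (To B) (Tm A B f)"
    by (rule rel_y[OF T_Obj[OF B] T_Hom[OF A B f]])
  finally show ?thesis .
qed

text \<open>In Kleisli form, \<Lambda> T(m (L s) r) becomes m (L \<Lambda>) \<Lambda> T(L s) (T r)
  by the multiplication axiom, then m (L \<Lambda>) L(T s) \<Lambda> (T r) by naturality, and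
  finally m L(\<Lambda> T s) (\<Lambda> T r), the Kleisli composite of the images.\<close>

lemma kleisli_extension_comp:
  assumes A: "A \<in> PO" and B: "B \<in> PO" and C: "C \<in> PO"
    and R: "R \<in> Rel A B" and S: "S \<in> Rel B C"
  shows "onHom (kleisli_extension \<Lambda>) A C (S O R) =
    onHom (kleisli_extension \<Lambda>) B C S O onHom (kleisli_extension \<Lambda>) A B R"
proof -
  define r where "r = name A R"
  define s where "s = name B S"
  note LB = LO_Obj[OF B] and LC = LO_Obj[OF C]
  note LLC = LO_Obj[OF LC] and TA = T_Obj[OF A] and TB = T_Obj[OF B] and TC = T_Obj[OF C]
  have r: "r \<in> hom A (LO B)" unfolding r_def by (rule name_Hom[OF A B R])
  have s: "s \<in> hom B (LO C)" unfolding s_def by (rule name_Hom[OF B C S])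
  have R_eq: "R = rel A r" and S_eq: "S = rel B s"
    by (simp_all add: r_def s_def rel_name[OF A B R] rel_name[OF B C S])
  note Ls = Lm_Hom[OF B LC]
  note Lsr = compose_Hom[OF r Ls]
  let ?r = "compose (Field (To A)) (\<Lambda> B) (Tm A (LO B) r)"
  let ?s = "compose (Field (To B)) (\<Lambda> C) (Tm B (LO C) s)"
  let ?k = "compose (Field A) (m C) (compose (Field A) (Lm B (LO C) s) r)"
  have "compose (Field (To A)) (\<Lambda> C) (Tm A (LO C) ?k) =
      compose (Field (To A)) (m (To C)) (compose (Field (To A)) (Lm (To B) (LO (To C)) ?s) ?r)"
  proof (intro extensionalityI[OF compose_extensional compose_extensional])
    fix x assume x: "x \<in> Field (To A)"
    define u where "u = Tm A (LO B) r x"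
    have u: "u \<in> Field (To (LO B))" unfolding u_def by (rule Hom_Field[OF T_Hom[OF A LB r] x])
    have lu: "\<Lambda> B u \<in> Field (LO (To B))" by (rule Hom_Field[OF law_Hom[OF B] u])
    have TLsu: "Tm (LO B) (LO (LO C)) (Lm B (LO C) s) u \<in> Field (To (LO (LO C)))"
      by (rule Hom_Field[OF T_Hom[OF LB LLC Ls] u])
    note Ts = T_Hom[OF B LC s]
    \<comment> \<open>Functoriality of L at the composite of T s with \<Lambda>, evaluated at
      \<open>\<Lambda> B u\<close>.\<close>
    have L_comp: "Lm (To (LO C)) (LO (To C)) (\<Lambda> C) (Lm (To B) (To (LO C)) (Tm B (LO C) s) (\<Lambda> B u)) =
        Lm (To B) (LO (To C)) ?s (\<Lambda> B u)"
    proof (rule dec_eqI)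
      note LTC = LO_Obj[OF TC] and TLC = T_Obj[OF LC]
      note LTs = Lm_Field[OF TLC lu, of "Tm B (LO C) s"]
      show "LO (To C) \<in> PO" by (rule LTC)
      show "Lm (To (LO C)) (LO (To C)) (\<Lambda> C) (Lm (To B) (To (LO C)) (Tm B (LO C) s) (\<Lambda> B u))
          \<in> Field (LO (LO (To C)))" by (rule Lm_Field[OF LTC LTs])
      show "Lm (To B) (LO (To C)) ?s (\<Lambda> B u) \<in> Field (LO (LO (To C)))"
        by (rule Lm_Field[OF LTC lu])
      have b: "b \<in> Field (To B)" if "b \<in> dec (\<Lambda> B u)" for b
        using dec_Field[OF TB lu that] .
      \<comment> \<open>From left to right, \<Lambda> is monotone and v \<le> T s b; from right to
        left, T s b is the witness.\<close>
      have "(\<exists>v\<in>{v. \<exists>b\<in>dec (\<Lambda> B u). (v, Tm B (LO C) s b) \<in> To (LO C)}. (c, \<Lambda> C v) \<in> LO (To C)) \<longleftrightarrow>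
          (\<exists>b\<in>dec (\<Lambda> B u). (c, \<Lambda> C (Tm B (LO C) s b)) \<in> LO (To C))" for c
        using b Hom_Field[OF Ts] Obj_refl[OF TLC] Obj_trans[OF LTC] Hom_mono[OF law_Hom[OF C]]
        by blast
      then show "dec (Lm (To (LO C)) (LO (To C)) (\<Lambda> C) (Lm (To B) (To (LO C)) (Tm B (LO C) s) (\<Lambda> B u))) =
          dec (Lm (To B) (LO (To C)) ?s (\<Lambda> B u))"
        by (simp add: dec_Lm[OF LTC LTs] dec_Lm[OF TLC lu] dec_Lm[OF LTC lu] compose_eq b
            cong: bex_cong)
    qed
    have "\<Lambda> C (Tm A (LO C) ?k x) = \<Lambda> C (Tm (LO (LO C)) (LO C) (m C) (Tm (LO B) (LO (LO C)) (Lm B (LO C) s) u))"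
      by (simp add: T_compose_app[OF A LLC LC Lsr m_Hom[OF C] x] T_compose_app[OF A LB LLC r Ls x] u_def)
    also have "\<dots> = m (To C) (Lm (To B) (LO (To C)) ?s (\<Lambda> B u))"
      by (simp add: law_mult[OF C TLsu] law_natural[OF B LC s u] L_comp)
    finally show "compose (Field (To A)) (\<Lambda> C) (Tm A (LO C) ?k) x =
        compose (Field (To A)) (m (To C)) (compose (Field (To A)) (Lm (To B) (LO (To C)) ?s) ?r) x"
      using x by (simp add: compose_eq u_def)
  qed
  then have "onHom (kleisli_extension \<Lambda>) A C (rel A ?k) = rel (To B) ?s O rel (To A) ?r"
    using kleisli_extension_rel[OF A C compose_Hom[OF Lsr m_Hom[OF C]]]
      rel_kleisli[OF TA TB TC kleisli_Hom[OF A B r] kleisli_Hom[OF B C s]] by simp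
  then show ?thesis
    unfolding R_eq S_eq kleisli_extension_rel[OF A B r] kleisli_extension_rel[OF B C s]
      rel_kleisli[OF A B C r s] .
qed

text \<open>Inclusion of relations is the pointwise order of their names. T preserves it by local
  monotonicity, and the components of \<Lambda> are monotone.\<close>

lemma kleisli_extension_mono:
  assumes A: "A \<in> PO" and B: "B \<in> PO" and R: "R \<in> Rel A B" and S: "S \<in> Rel A B" and "R \<subseteq> S"
  shows "onHom (kleisli_extension \<Lambda>) A B R \<subseteq> onHom (kleisli_extension \<Lambda>) A B S"
proof -
  note LB = LO_Obj[OF B]
  note nR = name_Hom[OF A B R] and nS = name_Hom[OF A B S]
  have "(name A R a, name A S a) \<in> LO B" if "a \<in> Field A" for a
    using that \<open>R \<subseteq> S\<close> Hom_Field[OF nR] Hom_Field[OF nS]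
    by (auto simp: LO_iff[OF B] dec_name[OF A B R] dec_name[OF A B S])
  then have "(Tm A (LO B) (name A R) x, Tm A (LO B) (name A S) x) \<in> To (LO B)"
    if "x \<in> Field (To A)" for x
    using T_mono[OF A LB nR nS _ that] by blast
  then have "(\<Lambda> B (Tm A (LO B) (name A R) x), \<Lambda> B (Tm A (LO B) (name A S) x)) \<in> LO (To B)"
    if "x \<in> Field (To A)" for x
    using Hom_mono[OF law_Hom[OF B]] that by blast
  then show ?thesis
    unfolding LO_iff[OF T_Obj[OF B]]
    by (auto simp: kleisli_extension_def rel_def compose_eq) blast
qed

lemma kleisli_extension_functor:
  "two_functor (RelPre small) (RelPre small) (kleisli_extension \<Lambda>)"
proof -
  have obj: "onObj (kleisli_extension \<Lambda>) A = To A" for A by (simp add: kleisli_extension_def)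
  have "onHom (kleisli_extension \<Lambda>) A B R \<in> Rel (To A) (To B)"
    if "A \<in> PO" "B \<in> PO" "R \<in> Rel A B" for A B R
    using that rel_Hom[OF T_Obj T_Obj kleisli_Hom[OF _ _ name_Hom]] by (simp add: kleisli_extension_def)
  moreover have "onHom (kleisli_extension \<Lambda>) A A A = To A" if A: "A \<in> PO" for A
  proof -
    \<comment> \<open>The identity relation is the diamond of the identity map, so its preservation
      reduces to \<open>kleisli_extension_diamond\<close>.\<close>
    have dia: "onHom diamond X X (restrict (\<lambda>a. a) (Field X)) = X" for X :: "'u rel"
      by (auto simp: onHom_diamond intro: FieldI2)
    show ?thesis
      using kleisli_extension_diamond[OF A A id_Hom] by (simp add: dia T_Idt[OF A])
  qed
  ultimately show ?thesis
    unfolding two_functor_def Obj_RelPre RelPre_simps obj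
    by (intro conjI ballI impI)
      (simp_all add: T_Obj kleisli_extension_comp kleisli_extension_mono)
qed

lemma kleisli_extension_eq:
  "functor_eq (Pre small) (functor_comp (kleisli_extension \<Lambda>) diamond) (functor_comp diamond T)"
  using kleisli_extension_diamond
  by (simp add: functor_eq_def functor_comp_def onObj_diamond) (simp add: kleisli_extension_def)

end

end

section \<open>Equivalence of extension, Beck-Chevalley condition and distributive law\<close>

theorem theorem5p3:
  fixes small :: "'u set \<Rightarrow> bool"
    and code :: "'u set \<Rightarrow> 'u"
    and T :: "('u rel, 'u \<Rightarrow> 'u, 'u rel, 'u \<Rightarrow> 'u) functor_data"
  assumes "universe small code"
    and "two_functor (Pre small) (Pre small) T"
  shows "((\<exists>T' :: ('u rel, 'u rel, 'u rel, 'u rel) functor_data.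
             two_functor (RelPre small) (RelPre small) T' \<and>
             functor_eq (Pre small) (functor_comp T' diamond) (functor_comp diamond T))
          \<longleftrightarrow> preserves_exact_squares small T) \<and>
         (preserves_exact_squares small T
          \<longleftrightarrow> (\<exists>\<Lambda> :: 'u rel \<Rightarrow> 'u \<Rightarrow> 'u.
                distributive_law (Pre small) T (L small code) (yoneda code) (mult small code) \<Lambda>))"
proof -
  interpret pre_endo small code T
    by unfold_locales (rule assms)+
  show ?thesis
    using extension_imp_exact exact_imp_distributive_law kleisli_extension_functor
      kleisli_extension_eq by blast
qed

end
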